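(* Let $\mathcal{K}=\sum_i e_i\otimes e^i\in\mathcal{H}\otimes\tilde{\mathcal{H}}^*$ be the canonical element of the Hopf pairing between $\mathcal{H}$ and $\mathcal{H}^*$, the latter being identified with $\tilde{\mathcal{H}}^*$ as a linear space. Then $\mathcal{K}$ satisfies the characteristic equation $$(\Delta\otimes\mathrm{id})(\mathcal{K})=\mathcal{R}^{-1}\mathcal{K}_1\mathcal{R}\,\mathcal{K}_2$$ and the reflection equation $$\mathcal{R}_{21}\mathcal{K}_1\mathcal{R}\,\mathcal{K}_2=\mathcal{K}_2\mathcal{R}_{21}\mathcal{K}_1\mathcal{R}$$ in $\mathcal{H}\otimes\mathcal{H}\otimes\tilde{\mathcal{H}}^*$.
   Context: $\mathbf{k}$ is a commutative algebra over a field of characteristic zero; all algebras and tensor products are over $\mathbf{k}$. $\mathcal{H}$ is a quasitriangular Hopf algebra over $\mathbf{k}$ with coproduct $\Delta$, counit $\varepsilon$, antipode $\gamma$ and (invertible) universal R-matrix $\mathcal{R}=\mathcal{R}_1\otimes\mathcal{R}_2$ (summation suppressed), i.e. $(\Delta\otimes\mathrm{id})(\mathcal{R})=\mathcal{R}_{13}\mathcal{R}_{23}$, $(\mathrm{id}\otimes\Delta)(\mathcal{R})=\mathcal{R}_{13}\mathcal{R}_{12}$, and $\mathcal{R}\Delta(x)=\Delta^{op}(x)\mathcal{R}$ for all $x\in\mathcal{H}$. Primes distinguish different copies of $\mathcal{R}$. $\mathcal{H}^*$ is the Hopf dual of $\mathcal{H}$, with $\langle ab,x\rangle=\langle a,x_{(1)}\rangle\langle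 b,x_{(2)}\rangle$ and $\langle a,xy\rangle=\langle a_{(1)},x\rangle\langle a_{(2)},y\rangle$. The coregular actions are $x\triangleright a=a_{(1)}\langle a_{(2)},x\rangle$ and $a\triangleleft x=\langle a_{(1)},x\rangle a_{(2)}$. The RE dual $\tilde{\mathcal{H}}^*$ is the linear space $\mathcal{H}^*$ with the new associative multiplication $$\tilde m(a\otimes b)=m\bigl(\mathcal{R}_1\triangleright a\triangleleft\mathcal{R}_{1'}\otimes b\triangleleft\gamma(\mathcal{R}_2)\triangleleft\mathcal{R}_{2'}\bigr),$$ where $m$ is the multiplication of $\mathcal{H}^*$. (Equivalently, it is the twist of the left $\mathcal{H}^{op}\otimes\mathcal{H}$-module algebra $\mathcal{H}^*$, with action $(x\otimes y)\cdot a=y\triangleright a\triangleleft\gamma(x)$, by the cocycle $\mathcal{R}_{13}\mathcal{R}_{23}$; here $\mathcal{H}^{op}$ is $\mathcal{H}$ with opposite coproduct.) $\{e_i\}$ is a base of $\mathcal{H}$ and $\{e^i\}$ the dual base of $\mathcal{H}^*$; if $\mathcal{H}$ is infinite dimensional, $\mathcal{K}$ is understood in an appropriately topologized (completed) tensor product. $\mathcal{K}_1=\sum_i e_i\otimes1\otimes e^i$, $\mathcal{K}_2=\sum_i1\otimes e_i\otimes e^i$, $\mathcal{R}$ stands for $\mathcal{R}\otimes1$, and $\mathcal{R}_{21}$ is $\mathcal{R}$ with its two factors flipped (tensored with $1$). *)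

theory Defs
  imports Complex_Main "HOL-Library.Poly_Mapping"
begin

section \<open>Formal linear combinations and tensor products\<close>

text \<open>
  An element \<open>t :: 'a \<Rightarrow>\<^sub>0 'k\<close> is a formal \<open>'k\<close>-linear combination of elements of \<open>'a\<close>.
\<close>

definition fscale :: "'k::comm_ring_1 \<Rightarrow> ('a \<Rightarrow>\<^sub>0 'k) \<Rightarrow> ('a \<Rightarrow>\<^sub>0 'k)" where
  "fscale c t = Poly_Mapping.map ((*) c) t"

lemma lookup_fscale: "Poly_Mapping.lookup (fscale c t) p = c * Poly_Mapping.lookup t p"
  unfolding fscale_def by (transfer, auto simp: when_def)

interpretation formal: module fscale
  by standard (auto intro!: poly_mapping_eqI simp: lookup_fscale lookup_add algebra_simps)

definition lin_ext ::
  "('k::comm_ring_1 \<Rightarrow> 'm::ab_group_add \<Rightarrow> 'm) \<Rightarrow> ('a \<Rightarrow> 'm) \<Rightarrow> ('a \<Rightarrow>\<^sub>0 'k) \<Rightarrow> 'm" where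
  "lin_ext s f t = (\<Sum>p\<in>Poly_Mapping.keys t. s (Poly_Mapping.lookup t p) (f p))"

abbreviation gen :: "'a \<Rightarrow> ('a \<Rightarrow>\<^sub>0 'k::comm_ring_1)" where
  "gen p \<equiv> Poly_Mapping.single p 1"

definition push :: "('a \<Rightarrow> 'b) \<Rightarrow> ('a \<Rightarrow>\<^sub>0 'k) \<Rightarrow> ('b \<Rightarrow>\<^sub>0 'k::comm_ring_1)" where
  "push f t = lin_ext fscale (\<lambda>p. gen (f p)) t"

text \<open>
  The tensor products \<open>H \<otimes> H\<close> and \<open>H \<otimes> H \<otimes> H\<close> over the ground ring are the modules of formal
  combinations of pairs, respectively triples, modulo the submodule spanned by the multilinearity
  relators.  Tensors are handled through representatives: \<open>gen (x, y)\<close> represents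
  \<open>x \<otimes> y\<close>, and \<open>tensor_eq2\<close>, \<open>tensor_eq3\<close> are equality in the tensor product.
\<close>

definition relators2 ::
  "('k::comm_ring_1 \<Rightarrow> 'h::ab_group_add \<Rightarrow> 'h) \<Rightarrow> ('h \<times> 'h \<Rightarrow>\<^sub>0 'k) set" where
  "relators2 s =
     {gen (x + x', y) - gen (x, y) - gen (x', y) | x x' y. True} \<union>
     {gen (x, y + y') - gen (x, y) - gen (x, y') | x y y'. True} \<union>
     {gen (s c x, y) - fscale c (gen (x, y)) | c x y. True} \<union>
     {gen (x, s c y) - fscale c (gen (x, y)) | c x y. True}"

definition relators3 ::
  "('k::comm_ring_1 \<Rightarrow> 'h::ab_group_add \<Rightarrow> 'h) \<Rightarrow> ('h \<times> 'h \<times> 'h \<Rightarrow>\<^sub>0 'k) set" where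
  "relators3 s =
     {gen (x + x', y, z) - gen (x, y, z) - gen (x', y, z) | x x' y z. True} \<union>
     {gen (x, y + y', z) - gen (x, y, z) - gen (x, y', z) | x y y' z. True} \<union>
     {gen (x, y, z + z') - gen (x, y, z) - gen (x, y, z') | x y z z'. True} \<union>
     {gen (s c x, y, z) - fscale c (gen (x, y, z)) | c x y z. True} \<union>
     {gen (x, s c y, z) - fscale c (gen (x, y, z)) | c x y z. True} \<union>
     {gen (x, y, s c z) - fscale c (gen (x, y, z)) | c x y z. True}"

definition tensor_eq2 ::
  "('k::comm_ring_1 \<Rightarrow> 'h::ab_group_add \<Rightarrow> 'h) \<Rightarrow> ('h \<times> 'h \<Rightarrow>\<^sub>0 'k) \<Rightarrow> ('h \<times> 'h \<Rightarrow>\<^sub>0 'k) \<Rightarrow> bool" where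
  "tensor_eq2 s t u \<longleftrightarrow> t - u \<in> formal.span (relators2 s)"

definition tensor_eq3 ::
  "('k::comm_ring_1 \<Rightarrow> 'h::ab_group_add \<Rightarrow> 'h) \<Rightarrow>
     ('h \<times> 'h \<times> 'h \<Rightarrow>\<^sub>0 'k) \<Rightarrow> ('h \<times> 'h \<times> 'h \<Rightarrow>\<^sub>0 'k) \<Rightarrow> bool" where
  "tensor_eq3 s t u \<longleftrightarrow> t - u \<in> formal.span (relators3 s)"

definition tmult2 ::
  "('h::ring_1 \<times> 'h \<Rightarrow>\<^sub>0 'k::comm_ring_1) \<Rightarrow> ('h \<times> 'h \<Rightarrow>\<^sub>0 'k) \<Rightarrow> ('h \<times> 'h \<Rightarrow>\<^sub>0 'k)" where
  "tmult2 t u = lin_ext fscale (\<lambda>(a, b). lin_ext fscale (\<lambda>(c, d). gen (a * c, b * d)) u) t"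

definition tmult3 ::
  "('h::ring_1 \<times> 'h \<times> 'h \<Rightarrow>\<^sub>0 'k::comm_ring_1) \<Rightarrow> ('h \<times> 'h \<times> 'h \<Rightarrow>\<^sub>0 'k) \<Rightarrow>
     ('h \<times> 'h \<times> 'h \<Rightarrow>\<^sub>0 'k)" where
  "tmult3 t u =
     lin_ext fscale (\<lambda>(a, b, c).
       lin_ext fscale (\<lambda>(a', b', c'). gen (a * a', b * b', c * c')) u) t"

definition comult_id ::
  "('h \<Rightarrow> ('h \<times> 'h \<Rightarrow>\<^sub>0 'k::comm_ring_1)) \<Rightarrow> ('h \<times> 'h \<Rightarrow>\<^sub>0 'k) \<Rightarrow> ('h \<times> 'h \<times> 'h \<Rightarrow>\<^sub>0 'k)" where
  "comult_id \<Delta> t = lin_ext fscale (\<lambda>(a, b). push (\<lambda>(a1, a2). (a1, a2, b)) (\<Delta> a)) t"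

definition id_comult ::
  "('h \<Rightarrow> ('h \<times> 'h \<Rightarrow>\<^sub>0 'k::comm_ring_1)) \<Rightarrow> ('h \<times> 'h \<Rightarrow>\<^sub>0 'k) \<Rightarrow> ('h \<times> 'h \<times> 'h \<Rightarrow>\<^sub>0 'k)" where
  "id_comult \<Delta> t = lin_ext fscale (\<lambda>(a, b). push (\<lambda>(b1, b2). (a, b1, b2)) (\<Delta> b)) t"

definition leg12 :: "('h::ring_1 \<times> 'h \<Rightarrow>\<^sub>0 'k::comm_ring_1) \<Rightarrow> ('h \<times> 'h \<times> 'h \<Rightarrow>\<^sub>0 'k)" where
  "leg12 = push (\<lambda>(a, b). (a, b, 1))"

definition leg13 :: "('h::ring_1 \<times> 'h \<Rightarrow>\<^sub>0 'k::comm_ring_1) \<Rightarrow> ('h \<times> 'h \<times> 'h \<Rightarrow>\<^sub>0 'k)" where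
  "leg13 = push (\<lambda>(a, b). (a, 1, b))"

definition leg23 :: "('h::ring_1 \<times> 'h \<Rightarrow>\<^sub>0 'k::comm_ring_1) \<Rightarrow> ('h \<times> 'h \<times> 'h \<Rightarrow>\<^sub>0 'k)" where
  "leg23 = push (\<lambda>(a, b). (1, a, b))"

definition flip :: "('h \<times> 'h \<Rightarrow>\<^sub>0 'k::comm_ring_1) \<Rightarrow> ('h \<times> 'h \<Rightarrow>\<^sub>0 'k)" where
  "flip = push (\<lambda>(a, b). (b, a))"


section \<open>Quasitriangular Hopf algebras\<close>

text \<open>The multiplication and unit of the Hopf algebra are those of the type class \<open>ring_1\<close>.\<close>

locale hopf_algebra = module scale
  for scale :: "'k::comm_ring_1 \<Rightarrow> 'h::ring_1 \<Rightarrow> 'h" +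
  fixes \<Delta> :: "'h \<Rightarrow> ('h \<times> 'h \<Rightarrow>\<^sub>0 'k)"
    and \<epsilon> :: "'h \<Rightarrow> 'k"
    and \<gamma> :: "'h \<Rightarrow> 'h"
  assumes scale_mult_left: "scale c x * y = scale c (x * y)"
    and scale_mult_right: "x * scale c y = scale c (x * y)"
    and comult_add: "tensor_eq2 scale (\<Delta> (x + y)) (\<Delta> x + \<Delta> y)"
    and comult_scale: "tensor_eq2 scale (\<Delta> (scale c x)) (fscale c (\<Delta> x))"
    and comult_mult: "tensor_eq2 scale (\<Delta> (x * y)) (tmult2 (\<Delta> x) (\<Delta> y))"
    and comult_one: "tensor_eq2 scale (\<Delta> 1) (gen (1, 1))"
    and coassoc: "tensor_eq3 scale (comult_id \<Delta> (\<Delta> x)) (id_comult \<Delta> (\<Delta> x))"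
    and counit_linear: "module_hom scale (*) \<epsilon>"
    and counit_mult: "\<epsilon> (x * y) = \<epsilon> x * \<epsilon> y"
    and counit_one: "\<epsilon> 1 = 1"
    and counit_left: "lin_ext scale (\<lambda>(x1, x2). scale (\<epsilon> x1) x2) (\<Delta> x) = x"
    and counit_right: "lin_ext scale (\<lambda>(x1, x2). scale (\<epsilon> x2) x1) (\<Delta> x) = x"
    and antipode_linear: "module_hom scale scale \<gamma>"
    and antipode_left: "lin_ext scale (\<lambda>(x1, x2). \<gamma> x1 * x2) (\<Delta> x) = scale (\<epsilon> x) 1"
    and antipode_right: "lin_ext scale (\<lambda>(x1, x2). x1 * \<gamma> x2) (\<Delta> x) = scale (\<epsilon> x) 1"

locale quasitriangular_hopf_algebra = hopf_algebra scale \<Delta> \<epsilon> \<gamma>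
  for scale :: "'k::comm_ring_1 \<Rightarrow> 'h::ring_1 \<Rightarrow> 'h"
    and \<Delta> :: "'h \<Rightarrow> ('h \<times> 'h \<Rightarrow>\<^sub>0 'k)"
    and \<epsilon> :: "'h \<Rightarrow> 'k"
    and \<gamma> :: "'h \<Rightarrow> 'h" +
  fixes R Rinv :: "'h \<times> 'h \<Rightarrow>\<^sub>0 'k"
  assumes R_Rinv: "tensor_eq2 scale (tmult2 R Rinv) (gen (1, 1))"
    and Rinv_R: "tensor_eq2 scale (tmult2 Rinv R) (gen (1, 1))"
    and comult_id_R: "tensor_eq3 scale (comult_id \<Delta> R) (tmult3 (leg13 R) (leg23 R))"
    and id_comult_R: "tensor_eq3 scale (id_comult \<Delta> R) (tmult3 (leg13 R) (leg12 R))"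
    and R_intertwines: "tensor_eq2 scale (tmult2 R (\<Delta> x)) (tmult2 (flip (\<Delta> x)) R)"


section \<open>The dual and the RE dual\<close>

text \<open>
  \<open>H\<^sup>*\<close> consists of the linear functionals on \<open>H\<close>, so that \<open>\<langle>a, x\<rangle>\<close> is the value \<open>a x\<close>.
  By \<open>\<langle>a, x y\<rangle> = \<langle>a\<^sub>(\<^sub>1\<^sub>), x\<rangle> \<langle>a\<^sub>(\<^sub>2\<^sub>), y\<rangle>\<close>, the coregular actions
  \<open>x \<triangleright> a = a\<^sub>(\<^sub>1\<^sub>) \<langle>a\<^sub>(\<^sub>2\<^sub>), x\<rangle>\<close> and \<open>a \<triangleleft> x = \<langle>a\<^sub>(\<^sub>1\<^sub>), x\<rangle> a\<^sub>(\<^sub>2\<^sub>)\<close> are the functionals below; this form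
  also makes sense when \<open>a\<close> has an infinite coproduct.
\<close>

definition dual_mult ::
  "('h \<Rightarrow> ('h \<times> 'h \<Rightarrow>\<^sub>0 'k::comm_ring_1)) \<Rightarrow> ('h \<Rightarrow> 'k) \<Rightarrow> ('h \<Rightarrow> 'k) \<Rightarrow> ('h \<Rightarrow> 'k)" where
  "dual_mult \<Delta> a b = (\<lambda>x. lin_ext (*) (\<lambda>(x1, x2). a x1 * b x2) (\<Delta> x))"

definition lcoreg :: "'h::ring_1 \<Rightarrow> ('h \<Rightarrow> 'k) \<Rightarrow> ('h \<Rightarrow> 'k)" (infixr \<open>\<triangleright>\<close> 75) where
  "x \<triangleright> a = (\<lambda>h. a (h * x))"

definition rcoreg :: "('h \<Rightarrow> 'k) \<Rightarrow> 'h::ring_1 \<Rightarrow> ('h \<Rightarrow> 'k)" (infixl \<open>\<triangleleft>\<close> 74) where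
  "a \<triangleleft> x = (\<lambda>h. a (x * h))"

definition re_mult ::
  "('h::ring_1 \<Rightarrow> ('h \<times> 'h \<Rightarrow>\<^sub>0 'k::comm_ring_1)) \<Rightarrow> ('h \<Rightarrow> 'h) \<Rightarrow> ('h \<times> 'h \<Rightarrow>\<^sub>0 'k) \<Rightarrow>
     ('h \<Rightarrow> 'k) \<Rightarrow> ('h \<Rightarrow> 'k) \<Rightarrow> ('h \<Rightarrow> 'k)" where
  "re_mult \<Delta> \<gamma> R a b =
     (\<lambda>h. lin_ext (*) (\<lambda>(r1, r2). lin_ext (*) (\<lambda>(r1', r2').
        dual_mult \<Delta> (r1 \<triangleright> a \<triangleleft> r1') (b \<triangleleft> \<gamma> r2 \<triangleleft> r2') h) R) R)"

definition is_base :: "('k::comm_ring_1 \<Rightarrow> 'h::ab_group_add \<Rightarrow> 'h) \<Rightarrow> ('i \<Rightarrow> 'h) \<Rightarrow> bool" where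
  "is_base scale e \<longleftrightarrow>
     inj e \<and> \<not> module.dependent scale (range e) \<and> module.span scale (range e) = UNIV"

definition dual_base ::
  "('k::comm_ring_1 \<Rightarrow> 'h::ab_group_add \<Rightarrow> 'h) \<Rightarrow> ('i \<Rightarrow> 'h) \<Rightarrow> 'i \<Rightarrow> 'h \<Rightarrow> 'k" where
  "dual_base scale e i = (\<lambda>x. module.representation scale (range e) x (e i))"


section \<open>The completed tensor product with the RE dual\<close>

text \<open>
  An element \<open>\<Sum>\<^sub>i v\<^sub>i \<otimes> e\<^sup>i\<close> of the tensor product of \<open>V\<close> with the RE dual, completed with respect
  to the dual base, is the family \<open>v\<close> of its coefficients.  For a finite base this
  is the algebraic tensor product; for an infinite one arbitrary families are allowed, which is the
  completion for the topology of pointwise convergence on functionals.  A functional \<open>a\<close> expands as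
  \<open>\<Sum>\<^sub>i \<langle>a, e\<^sub>i\<rangle> e\<^sup>i\<close>.
  Families with values in \<open>H \<otimes> H\<close> are compared coefficientwise in \<open>H \<otimes> H\<close>.
\<close>

definition compl_eq ::
  "('k::comm_ring_1 \<Rightarrow> 'h::ab_group_add \<Rightarrow> 'h) \<Rightarrow>
     ('i \<Rightarrow> ('h \<times> 'h \<Rightarrow>\<^sub>0 'k)) \<Rightarrow> ('i \<Rightarrow> ('h \<times> 'h \<Rightarrow>\<^sub>0 'k)) \<Rightarrow> bool" where
  "compl_eq scale X Y \<longleftrightarrow> (\<forall>i. tensor_eq2 scale (X i) (Y i))"

text \<open>
  Bilinear and continuous extension of \<open>(x \<otimes> a) (y \<otimes> b) = x y \<otimes> m\<^sup>~(a \<otimes> b)\<close>: the coefficient of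
  \<open>(\<Sum>\<^sub>i x\<^sub>i \<otimes> e\<^sup>i) (\<Sum>\<^sub>j y\<^sub>j \<otimes> e\<^sup>j)\<close> at \<open>e\<^sup>k\<close> is the sum over \<open>i, j\<close> of
  \<open>\<langle>m\<^sup>~(e\<^sup>i \<otimes> e\<^sup>j), e\<^sub>k\<rangle> x\<^sub>i y\<^sub>j\<close>.  This sum is finite, see \<open>finite_re_mult_coeffs\<close>.
\<close>

definition compl_mult ::
  "('k::comm_ring_1 \<Rightarrow> 'h::ring_1 \<Rightarrow> 'h) \<Rightarrow> ('i \<Rightarrow> 'h) \<Rightarrow>
     ('h \<Rightarrow> ('h \<times> 'h \<Rightarrow>\<^sub>0 'k)) \<Rightarrow> ('h \<Rightarrow> 'h) \<Rightarrow> ('h \<times> 'h \<Rightarrow>\<^sub>0 'k) \<Rightarrow>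
     ('i \<Rightarrow> ('h \<times> 'h \<Rightarrow>\<^sub>0 'k)) \<Rightarrow> ('i \<Rightarrow> ('h \<times> 'h \<Rightarrow>\<^sub>0 'k)) \<Rightarrow> ('i \<Rightarrow> ('h \<times> 'h \<Rightarrow>\<^sub>0 'k))" where
  "compl_mult scale e \<Delta> \<gamma> R X Y =
     (\<lambda>k. Sum_any (\<lambda>(i, j).
        fscale (re_mult \<Delta> \<gamma> R (dual_base scale e i) (dual_base scale e j) (e k))
          (tmult2 (X i) (Y j))))"

lemma finite_re_mult_coeffs:
  assumes "module scale" and "is_base scale e"
  shows "finite {(i, j). re_mult \<Delta> \<gamma> R (dual_base scale e i) (dual_base scale e j) h \<noteq> 0}"
proof -
  interpret module scale by fact
  have fin: "finite {i. dual_base scale e i x \<noteq> 0}" for x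
  proof -
    have "e ` {i. dual_base scale e i x \<noteq> 0} \<subseteq> {b. representation (range e) x b \<noteq> 0}"
      by (auto simp: dual_base_def)
    then have "finite (e ` {i. dual_base scale e i x \<noteq> 0})"
      using finite_representation finite_subset by blast
    then show ?thesis
      using assms(2) by (auto simp: is_base_def intro: finite_imageD inj_on_subset)
  qed
  define S where "S = (\<Union>r\<in>Poly_Mapping.keys R. \<Union>r'\<in>Poly_Mapping.keys R. \<Union>x\<in>Poly_Mapping.keys (\<Delta> h).
      {i. dual_base scale e i (fst r' * (fst x * fst r)) \<noteq> 0} \<times>
      {j. dual_base scale e j (\<gamma> (snd r) * (snd r' * snd x)) \<noteq> 0})"
  have "finite S" unfolding S_def using fin by (intro finite_UN_I finite_cartesian_product) auto
  moreover have "{(i, j). re_mult \<Delta> \<gamma> R (dual_base scale e i) (dual_base scale e j) h \<noteq> 0} \<subseteq> S"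
  proof safe
    fix i j assume nz: "re_mult \<Delta> \<gamma> R (dual_base scale e i) (dual_base scale e j) h \<noteq> 0"
    show "(i, j) \<in> S"
    proof (rule ccontr)
      assume "(i, j) \<notin> S"
      then have z: "dual_base scale e i (fst r' * (fst x * fst r)) *
          dual_base scale e j (\<gamma> (snd r) * (snd r' * snd x)) = 0"
        if "r \<in> Poly_Mapping.keys R" "r' \<in> Poly_Mapping.keys R" "x \<in> Poly_Mapping.keys (\<Delta> h)" for r r' x
        using that unfolding S_def by fastforce
      have "re_mult \<Delta> \<gamma> R (dual_base scale e i) (dual_base scale e j) h = 0"
        unfolding re_mult_def lin_ext_def dual_mult_def lcoreg_def rcoreg_def
        by (auto intro!: sum.neutral simp: case_prod_beta z mult.assoc)
      with nz show False by simp
    qed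
  qed
  ultimately show ?thesis by (rule rev_finite_subset)
qed

text \<open>
  \<open>dual_tensor_one e \<epsilon> t\<close> is \<open>t \<otimes> 1\<close>; the unit of the RE dual is the counit \<open>\<epsilon> = \<Sum>\<^sub>i \<epsilon>(e\<^sub>i) e\<^sup>i\<close>.
\<close>

definition dual_tensor_one ::
  "('i \<Rightarrow> 'h) \<Rightarrow> ('h \<Rightarrow> 'k::comm_ring_1) \<Rightarrow> ('h \<times> 'h \<Rightarrow>\<^sub>0 'k) \<Rightarrow> ('i \<Rightarrow> ('h \<times> 'h \<Rightarrow>\<^sub>0 'k))" where
  "dual_tensor_one e \<epsilon> t = (\<lambda>i. fscale (\<epsilon> (e i)) t)"

definition canonical_element :: "('i \<Rightarrow> 'h) \<Rightarrow> ('i \<Rightarrow> 'h)" where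
  "canonical_element e = (\<lambda>i. e i)"

definition compl_comult_id ::
  "('h \<Rightarrow> ('h \<times> 'h \<Rightarrow>\<^sub>0 'k::comm_ring_1)) \<Rightarrow> ('i \<Rightarrow> 'h) \<Rightarrow> ('i \<Rightarrow> ('h \<times> 'h \<Rightarrow>\<^sub>0 'k))" where
  "compl_comult_id \<Delta> X = (\<lambda>i. \<Delta> (X i))"

definition compl_leg1 :: "('i \<Rightarrow> 'h::ring_1) \<Rightarrow> ('i \<Rightarrow> ('h \<times> 'h \<Rightarrow>\<^sub>0 'k::comm_ring_1))" where
  "compl_leg1 X = (\<lambda>i. gen (X i, 1))"

definition compl_leg2 :: "('i \<Rightarrow> 'h::ring_1) \<Rightarrow> ('i \<Rightarrow> ('h \<times> 'h \<Rightarrow>\<^sub>0 'k::comm_ring_1))" where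
  "compl_leg2 X = (\<lambda>i. gen (1, X i))"

end

(*
  A base of H makes H a free module, so an equality in H \<otimes> H can be tested on k-valued bilinear
  forms, and all computations become manipulations of finite sums in k.  If two elements of the
  completed tensor product have coefficients F(e_i) and G(e_i) for linear maps F and G, then their
  product has the coefficients Z(e_k), where
    Z(h) = \<Sum> F(R_1' h_(1) R_1) G(\<gamma>(R_2) R_2' h_(2)).
  Hence \<epsilon> is a unit, because (\<epsilon> \<otimes> id)(R) = 1 = (id \<otimes> \<epsilon>)(R).  Applying the antipode to the last leg of
  (id \<otimes> \<Delta>)(R) = R_13 R_12 and multiplying the last two legs gives
    \<Sum> R_1 R_1'' \<otimes> R_2'' \<gamma>(R_2) = 1 \<otimes> 1,
  so that K_1 R K_2 has the coefficients R \<Delta>(e_k) and K_2 R_21 K_1 the coefficients flip (R \<Delta>(e_k)).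
  Both equations follow, the reflection equation by R \<Delta> = \<Delta>^op R.
*)
theory Submission
  imports Defs
begin

section \<open>Linear extensions and contractions\<close>

lemma module_mult: "module ((*) :: 'k::comm_ring_1 \<Rightarrow> 'k \<Rightarrow> 'k)"
  by standard (auto simp: algebra_simps)

lemma module_fscale: "module (fscale :: 'k::comm_ring_1 \<Rightarrow> _)"
  by (rule formal.module_axioms)

lemma module_homI:
  assumes "module s1" "module s2" "\<And>x y. f (x + y) = f x + f y" "\<And>c x. f (s1 c x) = s2 c (f x)"
  shows "module_hom s1 s2 f"
  using assms by (auto simp: module_hom_def module_hom_axioms_def)

text \<open>Cancellation can shrink supports under addition and scaling, also because the ground
  ring may have zero divisors. Summing over a common finite superset makes two linear extensions
  comparable term by term.\<close>

lemma lin_ext_superset: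
  assumes "module s" "finite A" "Poly_Mapping.keys t \<subseteq> A"
  shows "lin_ext s f t = (\<Sum>p\<in>A. s (Poly_Mapping.lookup t p) (f p))"
proof -
  interpret module s by fact
  show ?thesis
    unfolding lin_ext_def using assms(2,3)
    by (intro sum.mono_neutral_left) (auto simp: in_keys_iff)
qed

lemma module_hom_lin_ext:
  fixes s :: "'b::comm_ring_1 \<Rightarrow> 'm::ab_group_add \<Rightarrow> 'm" and f :: "'a \<Rightarrow> 'm"
  assumes "module s"
  shows "module_hom fscale s (lin_ext s f)"
proof (rule module_homI[OF module_fscale assms])
  interpret module s by fact
  fix t u :: "'a \<Rightarrow>\<^sub>0 'b" and c
  have "lin_ext s f (t + u) = (\<Sum>p\<in>Poly_Mapping.keys t \<union> Poly_Mapping.keys u. s (Poly_Mapping.lookup (t + u) p) (f p))"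
    using Poly_Mapping.keys_add[of t u] by (intro lin_ext_superset[OF assms]) auto
  also have "\<dots> = lin_ext s f t + lin_ext s f u"
    by (simp add: lookup_add scale_left_distrib sum.distrib
        lin_ext_superset[OF assms, where A = "Poly_Mapping.keys t \<union> Poly_Mapping.keys u"])
  finally show "lin_ext s f (t + u) = lin_ext s f t + lin_ext s f u" .
  have "lin_ext s f (fscale c t) = (\<Sum>p\<in>Poly_Mapping.keys t. s (Poly_Mapping.lookup (fscale c t) p) (f p))"
    by (intro lin_ext_superset[OF assms]) (auto simp: in_keys_iff lookup_fscale)
  then show "lin_ext s f (fscale c t) = s c (lin_ext s f t)"
    by (simp add: lin_ext_def lookup_fscale scale_sum_right)
qed

lemma lin_ext_gen: "module s \<Longrightarrow> lin_ext s f (gen p) = f p"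
  by (simp add: lin_ext_def module.scale_one)

lemma hom_lin_ext:
  assumes "module_hom s1 s2 \<phi>"
  shows "\<phi> (lin_ext s1 f t) = lin_ext s2 (\<lambda>p. \<phi> (f p)) t"
proof -
  interpret module_hom s1 s2 \<phi> by fact
  show ?thesis by (simp add: lin_ext_def sum scale)
qed

lemma module_hom_lookup: "module_hom fscale (*) (\<lambda>t. Poly_Mapping.lookup t p)"
  by (rule module_homI[OF module_fscale module_mult]) (auto simp: lookup_add lookup_fscale)

lemmas lookup_lin_ext = hom_lin_ext[OF module_hom_lookup]

lemma lin_ext_eq_self: "lin_ext fscale gen t = t"
proof (rule poly_mapping_eqI)
  fix q
  have "(\<Sum>p\<in>Poly_Mapping.keys t. Poly_Mapping.lookup t p * Poly_Mapping.lookup (gen p) q)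
      = (\<Sum>p\<in>Poly_Mapping.keys t. if p = q then Poly_Mapping.lookup t q else 0)"
    by (intro sum.cong) (auto simp: lookup_single when_def)
  then show "Poly_Mapping.lookup (lin_ext fscale gen t) q = Poly_Mapping.lookup t q"
    unfolding lookup_lin_ext by (simp add: lin_ext_def in_keys_iff)
qed

text \<open>Scalar valued Sweedler notation: \<open>contract R (\<lambda>r. ...)\<close> is a sum
  over R with legs \<open>fst r\<close> and \<open>snd r\<close>. It is defined on representatives
  for an arbitrary \<open>f\<close>; only for multilinear \<open>f\<close> does it descend to the
  tensor product.\<close>

abbreviation contract :: "('a \<Rightarrow>\<^sub>0 'k::comm_ring_1) \<Rightarrow> ('a \<Rightarrow> 'k) \<Rightarrow> 'k" where
  "contract t f \<equiv> lin_ext (*) f t"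

lemmas module_hom_contract = module_hom_lin_ext[OF module_mult]

lemma contract_add: "contract (t + u) f = contract t f + contract u f"
  and contract_diff: "contract (t - u) f = contract t f - contract u f"
  and contract_fscale: "contract (fscale c t) f = c * contract t f"
  using module_hom.add[OF module_hom_contract] module_hom.diff[OF module_hom_contract]
    module_hom.scale[OF module_hom_contract] by auto

lemma contract_lin_ext: "contract (lin_ext fscale g t) f = contract t (\<lambda>p. contract (g p) f)"
  by (rule hom_lin_ext[OF module_hom_contract])

lemma contract_gen: "contract (gen p) f = f p"
  by (rule lin_ext_gen[OF module_mult])

lemma contract_push: "contract (push g t) f = contract t (\<lambda>p. f (g p))"
  by (simp add: push_def contract_lin_ext contract_gen)

lemma contract_tmult2:
  "contract (tmult2 t u) f = contract t (\<lambda>a. contract u (\<lambda>b. f (fst a * fst b, snd a * snd b)))"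
  by (simp add: tmult2_def contract_lin_ext contract_gen case_prod_unfold)

lemma contract_tmult3:
  "contract (tmult3 t u) f = contract t (\<lambda>a. contract u (\<lambda>b.
     f (fst a * fst b, fst (snd a) * fst (snd b), snd (snd a) * snd (snd b))))"
  by (simp add: tmult3_def contract_lin_ext contract_gen case_prod_unfold)

lemma contract_comult_id:
  "contract (comult_id \<Delta> t) f = contract t (\<lambda>a. contract (\<Delta> (fst a)) (\<lambda>x. f (fst x, snd x, snd a)))"
  by (simp add: comult_id_def contract_lin_ext contract_push case_prod_unfold)

lemma contract_id_comult:
  "contract (id_comult \<Delta> t) f = contract t (\<lambda>a. contract (\<Delta> (snd a)) (\<lambda>x. f (fst a, fst x, snd x)))"
  by (simp add: id_comult_def contract_lin_ext contract_push case_prod_unfold)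

lemma contract_legs:
  "contract (leg12 t) f = contract t (\<lambda>a. f (fst a, snd a, 1))"
  "contract (leg13 t) f = contract t (\<lambda>a. f (fst a, 1, snd a))"
  "contract (leg23 t) f = contract t (\<lambda>a. f (1, fst a, snd a))"
  "contract (flip t) g = contract t (\<lambda>a. g (snd a, fst a))"
  by (simp_all add: leg12_def leg13_def leg23_def flip_def contract_push case_prod_unfold)

lemmas contract_simps = contract_add contract_diff contract_fscale contract_gen
  contract_tmult2 contract_tmult3 contract_comult_id contract_id_comult contract_legs

lemma contract_mult_left: "contract t (\<lambda>p. c * f p) = c * contract t f"
  by (simp add: lin_ext_def sum_distrib_left mult.left_commute)

lemma contract_mult_right: "contract t (\<lambda>p. f p * c) = contract t f * c"
  by (simp add: lin_ext_def sum_distrib_right mult.assoc)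

lemma contract_swap:
  "contract t (\<lambda>a. contract u (\<lambda>b. f a b)) = contract u (\<lambda>b. contract t (\<lambda>a. f a b))"
  unfolding lin_ext_def sum_distrib_left
  by (subst sum.swap) (simp add: mult.left_commute)

section \<open>Multilinear functionals\<close>

definition bilinear_form ::
  "('k::comm_ring_1 \<Rightarrow> 'h::ab_group_add \<Rightarrow> 'h) \<Rightarrow> ('h \<times> 'h \<Rightarrow> 'k) \<Rightarrow> bool" where
  "bilinear_form s B \<longleftrightarrow>
     (\<forall>y. module_hom s (*) (\<lambda>x. B (x, y))) \<and> (\<forall>x. module_hom s (*) (\<lambda>y. B (x, y)))"

definition trilinear_form ::
  "('k::comm_ring_1 \<Rightarrow> 'h::ab_group_add \<Rightarrow> 'h) \<Rightarrow> ('h \<times> 'h \<times> 'h \<Rightarrow> 'k) \<Rightarrow> bool" where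
  "trilinear_form s B \<longleftrightarrow>
     (\<forall>y z. module_hom s (*) (\<lambda>x. B (x, y, z))) \<and> (\<forall>x z. module_hom s (*) (\<lambda>y. B (x, y, z))) \<and>
     (\<forall>x y. module_hom s (*) (\<lambda>z. B (x, y, z)))"

lemma contract_span_eq_0:
  assumes "t \<in> formal.span S" "\<And>r. r \<in> S \<Longrightarrow> contract r f = 0"
  shows "contract t f = 0"
  using assms(1)
  by (rule formal.span_induct_alt)
    (auto simp: contract_add contract_fscale assms(2) module_hom.zero[OF module_hom_contract])

text \<open>A bilinear form kills each of the four kinds of relators, hence their span. This
  direction needs no base; the converse is \<open>tensor_eq2I\<close>.\<close>

lemma tensor_eq2_contract:
  assumes "tensor_eq2 s t u" "bilinear_form s B"
  shows "contract t B = contract u B"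
proof -
  note lin = assms(2)[unfolded bilinear_form_def]
  note [simp] = module_hom.add[OF conjunct1[OF lin, rule_format]] module_hom.add[OF conjunct2[OF lin, rule_format]]
     module_hom.scale[OF conjunct1[OF lin, rule_format]] module_hom.scale[OF conjunct2[OF lin, rule_format]]
  have "contract (t - u) B = 0"
    using assms(1)[unfolded tensor_eq2_def]
    by (rule contract_span_eq_0) (auto simp: relators2_def contract_simps)
  then show ?thesis by (simp add: contract_diff)
qed

lemma tensor_eq3_contract:
  assumes "tensor_eq3 s t u" "trilinear_form s B"
  shows "contract t B = contract u B"
proof -
  have "module_hom s (*) (\<lambda>x. B (x, y, z))" "module_hom s (*) (\<lambda>x. B (y, x, z))"
    "module_hom s (*) (\<lambda>x. B (y, z, x))" for y z
    using assms(2) unfolding trilinear_form_def by auto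
  note [simp] = this[THEN module_hom.add] this[THEN module_hom.scale]
  have "contract (t - u) B = 0"
    using assms(1)[unfolded tensor_eq3_def]
    by (rule contract_span_eq_0) (auto simp: relators3_def contract_simps)
  then show ?thesis by (simp add: contract_diff)
qed

lemma bilinear_formI:
  assumes "\<And>y. module_hom s (*) (\<lambda>x. B (x, y))" "\<And>x. module_hom s (*) (\<lambda>y. B (x, y))"
  shows "bilinear_form s B"
  using assms by (auto simp: bilinear_form_def)

lemma trilinear_formI:
  assumes "\<And>y z. module_hom s (*) (\<lambda>x. B (x, y, z))" "\<And>x z. module_hom s (*) (\<lambda>y. B (x, y, z))"
    "\<And>x y. module_hom s (*) (\<lambda>z. B (x, y, z))"
  shows "trilinear_form s B"
  using assms by (auto simp: trilinear_form_def)

lemma bilinear_form_hom1: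
  assumes "bilinear_form s B" "module_hom s' s g"
  shows "module_hom s' (*) (\<lambda>x. B (g x, y))"
  using module_hom_compose[OF assms(2), of "(*)" "\<lambda>x. B (x, y)"] assms(1)
  by (simp add: bilinear_form_def comp_def)

lemma bilinear_form_hom2:
  assumes "bilinear_form s B" "module_hom s' s g"
  shows "module_hom s' (*) (\<lambda>x. B (y, g x))"
  using module_hom_compose[OF assms(2), of "(*)" "\<lambda>x. B (y, x)"] assms(1)
  by (simp add: bilinear_form_def comp_def)

lemma module_hom_contract_param:
  assumes "\<And>p. module_hom s (*) (\<lambda>x. f p x)"
  shows "module_hom s (*) (\<lambda>x. contract t (\<lambda>p. f p x))"
  using module_hom.axioms(1)[OF assms]
  by (rule module_homI[OF _ module_mult])
    (simp_all add: lin_ext_def module_hom.add[OF assms] module_hom.scale[OF assms]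
      distrib_left sum.distrib sum_distrib_left mult.left_commute)

lemma module_hom_mult_const:
  assumes "module_hom s (*) (f :: _ \<Rightarrow> 'k::comm_ring_1)"
  shows "module_hom s (*) (\<lambda>x. c * f x)" "module_hom s (*) (\<lambda>x. f x * c)"
  using module_hom.axioms(1)[OF assms]
  by (rule module_homI[OF _ module_mult];
    simp add: module_hom.add[OF assms] module_hom.scale[OF assms] algebra_simps)+

section \<open>Coordinates with respect to a base\<close>

text \<open>The coordinate vector is packed as a formal combination so that sums over the base
  become contractions. \<open>Abs_poly_mapping\<close> is meaningful here because the support is
  finite, as shown in \<open>lookup_coords\<close>.\<close>

definition coords ::
  "('k::comm_ring_1 \<Rightarrow> 'h::ab_group_add \<Rightarrow> 'h) \<Rightarrow> ('i \<Rightarrow> 'h) \<Rightarrow> 'h \<Rightarrow> ('i \<Rightarrow>\<^sub>0 'k)" where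
  "coords s e x = Abs_poly_mapping (\<lambda>i. dual_base s e i x)"

definition formal_tensor :: "('a \<Rightarrow>\<^sub>0 'k::comm_ring_1) \<Rightarrow> ('b \<Rightarrow>\<^sub>0 'k) \<Rightarrow> ('a \<times> 'b \<Rightarrow>\<^sub>0 'k)" where
  "formal_tensor a b = lin_ext fscale (\<lambda>i. push (Pair i) b) a"

lemma contract_formal_tensor:
  "contract (formal_tensor a b) f = contract a (\<lambda>i. contract b (\<lambda>j. f (i, j)))"
  by (simp add: formal_tensor_def contract_lin_ext contract_push)

lemma lookup_eq_contract:
  "Poly_Mapping.lookup t q = contract t (\<lambda>p. if p = q then 1 else 0)"
  by (simp add: lin_ext_def in_keys_iff if_distrib cong: if_cong)

lemma lookup_formal_tensor:
  "Poly_Mapping.lookup (formal_tensor a b) (i, j) = Poly_Mapping.lookup a i * Poly_Mapping.lookup b j"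
proof -
  have "Poly_Mapping.lookup (formal_tensor a b) (i, j) =
      contract a (\<lambda>i'. contract b (\<lambda>j'. (if i' = i then 1 else 0) * (if j' = j then 1 else 0)))"
    unfolding lookup_eq_contract contract_formal_tensor by (intro arg_cong2[where f = "lin_ext (*)"] ext refl) simp
  then show ?thesis
    by (simp only: contract_mult_left contract_mult_right lookup_eq_contract)
qed

section \<open>Free modules: bilinear forms separate tensors\<close>

locale module_with_base = module scale
  for scale :: "'k::comm_ring_1 \<Rightarrow> 'h::ab_group_add \<Rightarrow> 'h" +
  fixes e :: "'i \<Rightarrow> 'h"
  assumes base: "is_base scale e"
begin

lemma lookup_coords: "Poly_Mapping.lookup (coords scale e x) i = dual_base scale e i x"
proof -
  have "e ` {i. dual_base scale e i x \<noteq> 0} \<subseteq> {b. representation (range e) x b \<noteq> 0}"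
    by (auto simp: dual_base_def)
  then have "finite (e ` {i. dual_base scale e i x \<noteq> 0})"
    using finite_representation finite_subset by blast
  then have "finite {i. dual_base scale e i x \<noteq> 0}"
    using base by (auto simp: is_base_def intro: finite_imageD inj_on_subset)
  then show ?thesis by (simp add: coords_def)
qed

lemma module_hom_dual_base: "module_hom scale (*) (dual_base scale e i)"
  using base by (intro module_homI[OF module_axioms module_mult])
    (auto simp: is_base_def dual_base_def representation_add representation_scale)

lemma lin_ext_coords: "lin_ext scale e (coords scale e x) = x"
proof -
  have inj: "inj e" and ind: "independent (range e)" and sp: "x \<in> span (range e)"
    using base by (auto simp: is_base_def)
  let ?r = "representation (range e) x"
  \<comment> \<open>The representation vanishes off the base, so every vector with nonzero
    coefficient is some \<open>e i\<close>; the sum can then be reindexed along the injective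
    \<open>e\<close>.\<close>
  have keys: "e ` Poly_Mapping.keys (coords scale e x) = {b. ?r b \<noteq> 0}"
    using representation_ne_zero[of "range e" x]
    by (force simp: in_keys_iff lookup_coords dual_base_def)
  have "lin_ext scale e (coords scale e x) = (\<Sum>i\<in>Poly_Mapping.keys (coords scale e x). scale (?r (e i)) (e i))"
    by (simp add: lin_ext_def lookup_coords dual_base_def)
  also have "\<dots> = (\<Sum>b | ?r b \<noteq> 0. scale (?r b) b)"
    unfolding keys[symmetric] by (simp add: sum.reindex[OF inj_on_subset[OF inj subset_UNIV]])
  also have "\<dots> = x"
    by (rule sum_nonzero_representation_eq[OF ind sp])
  finally show ?thesis .
qed

lemma hom_eq_contract_coords:
  assumes "module_hom scale (*) \<phi>"
  shows "\<phi> x = contract (coords scale e x) (\<lambda>i. \<phi> (e i))"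
  using hom_lin_ext[OF assms, of e "coords scale e x"] by (simp add: lin_ext_coords)

lemma bilinear_form_eq_contract_coords:
  assumes "bilinear_form scale B"
  shows "B (x, y) = contract (coords scale e x) (\<lambda>i. contract (coords scale e y) (\<lambda>j. B (e i, e j)))"
proof -
  have "B (x, y) = contract (coords scale e x) (\<lambda>i. B (e i, y))"
    using assms by (intro hom_eq_contract_coords) (simp add: bilinear_form_def)
  moreover have "B (z, y) = contract (coords scale e y) (\<lambda>j. B (z, e j))" for z
    using assms by (intro hom_eq_contract_coords) (simp add: bilinear_form_def)
  ultimately show ?thesis by simp
qed

text \<open>Meant for maps such as x to \<open>gen (x, y)\<close>, which are linear only modulo the
  relators. Modulo \<open>N\<close> they commute with finite linear combinations, by induction on
  the number of terms.\<close>

lemma lin_ext_quotient: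
  fixes N :: "('a \<Rightarrow>\<^sub>0 'k) set" and \<phi> :: "'h \<Rightarrow> 'a \<Rightarrow>\<^sub>0 'k"
  assumes N: "formal.subspace N"
    and add: "\<And>x y. \<phi> (x + y) - \<phi> x - \<phi> y \<in> N"
    and scl: "\<And>c x. \<phi> (scale c x) - fscale c (\<phi> x) \<in> N"
  shows "\<phi> (lin_ext scale f a) - lin_ext fscale (\<lambda>i. \<phi> (f i)) a \<in> N"
proof -
  have "\<phi> (\<Sum>i\<in>A. scale (c i) (f i)) - (\<Sum>i\<in>A. fscale (c i) (\<phi> (f i))) \<in> N" if "finite A" for A c
    using that
  proof (induction A rule: finite_induct)
    case empty
    \<comment> \<open>The empty sum requires \<open>\<phi> 0\<close> to lie in \<open>N\<close>,
      which is homogeneity for the scalar 0.\<close>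
    show ?case using scl[of 0 0] by simp
  next
    case (insert i A)
    let ?x = "scale (c i) (f i)" and ?y = "\<Sum>i\<in>A. scale (c i) (f i)"
    have "(\<phi> (?x + ?y) - \<phi> ?x - \<phi> ?y) + (\<phi> ?x - fscale (c i) (\<phi> (f i)))
        + (\<phi> ?y - (\<Sum>i\<in>A. fscale (c i) (\<phi> (f i)))) \<in> N"
      using insert.IH add scl N by (intro formal.subspace_add) auto
    then show ?case using insert.hyps by (simp add: algebra_simps)
  qed
  then show ?thesis unfolding lin_ext_def by simp
qed

text \<open>The first leg is expanded with the second held fixed, then the second leg inside each
  resulting term; the two congruences add up.\<close>

lemma tensor_expand_base:
  "gen (x, y) - lin_ext fscale (\<lambda>(i, j). gen (e i, e j)) (formal_tensor (coords scale e x) (coords scale e y))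
     \<in> formal.span (relators2 scale)" (is "_ \<in> ?N")
proof -
  let ?cx = "coords scale e x" and ?cy = "coords scale e y"
  have N: "formal.subspace ?N" by simp
  have 1: "gen (x, y) - lin_ext fscale (\<lambda>i. gen (e i, y)) ?cx \<in> ?N"
    using lin_ext_quotient[OF N, of "\<lambda>x. gen (x, y)" e ?cx]
    by (force simp: lin_ext_coords relators2_def intro: formal.span_base)
  have 2: "gen (z, y) - lin_ext fscale (\<lambda>j. gen (z, e j)) ?cy \<in> ?N" for z
    using lin_ext_quotient[OF N, of "\<lambda>y. gen (z, y)" e ?cy]
    by (force simp: lin_ext_coords relators2_def intro: formal.span_base)
  have "lin_ext fscale (\<lambda>i. gen (e i, y)) ?cx
      - lin_ext fscale (\<lambda>i. lin_ext fscale (\<lambda>j. gen (e i, e j)) ?cy) ?cx \<in> ?N"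
    unfolding lin_ext_def[of _ _ ?cx] sum_subtractf[symmetric] formal.scale_right_diff_distrib[symmetric]
    by (intro formal.span_sum formal.span_scale 2)
  from formal.span_add[OF 1 this] show ?thesis
    by (simp add: formal_tensor_def push_def hom_lin_ext[OF module_hom_lin_ext[OF module_fscale]]
        lin_ext_gen[OF module_fscale])
qed

text \<open>The products of dual base functionals are bilinear forms that read off the coefficients
  at \<open>e i\<close>, \<open>e j\<close>. If they agree on \<open>t\<close> and \<open>u\<close>,
  the base expansion of \<open>t - u\<close> is zero, and by \<open>tensor_expand_base\<close> the
  difference is congruent to that expansion.\<close>

lemma tensor_eq2I:
  assumes "\<And>B. bilinear_form scale B \<Longrightarrow> contract t B = contract u B"
  shows "tensor_eq2 scale t u"
proof -
  let ?N = "formal.span (relators2 scale)"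
  let ?D = "\<lambda>p. formal_tensor (coords scale e (fst p)) (coords scale e (snd p))"
  let ?E = "lin_ext fscale (\<lambda>(i, j). gen (e i, e j))"
  have "Poly_Mapping.lookup (lin_ext fscale ?D (t - u)) (i, j) = 0" for i j
  proof -
    have "bilinear_form scale (\<lambda>p. dual_base scale e i (fst p) * dual_base scale e j (snd p))"
      by (intro bilinear_formI) (simp_all add: module_hom_mult_const module_hom_dual_base)
    from assms[OF this] show ?thesis
      by (simp add: lookup_lin_ext lookup_formal_tensor lookup_coords contract_diff)
  qed
  then have D0: "lin_ext fscale ?D (t - u) = 0"
    by (intro poly_mapping_eqI) auto
  have "lin_ext fscale gen (t - u) - lin_ext fscale (\<lambda>p. ?E (?D p)) (t - u) \<in> ?N"
    unfolding lin_ext_def[of _ _ "t - u"] sum_subtractf[symmetric] formal.scale_right_diff_distrib[symmetric]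
    using tensor_expand_base by (intro formal.span_sum formal.span_scale) force
  moreover have "lin_ext fscale (\<lambda>p. ?E (?D p)) (t - u) = 0"
    unfolding hom_lin_ext[OF module_hom_lin_ext[OF module_fscale], symmetric] D0
    by (simp add: lin_ext_def)
  ultimately show ?thesis by (simp add: lin_ext_eq_self tensor_eq2_def)
qed

end

section \<open>Counit and antipode on the R-matrix\<close>

context hopf_algebra
begin

lemma module_hom_mult_rule:
  assumes "module_hom s' scale g"
  shows "module_hom s' scale (\<lambda>x. a * g x)" "module_hom s' scale (\<lambda>x. g x * a)"
  using module_hom.axioms(1)[OF assms]
  by (rule module_homI[OF _ module_axioms];
    simp add: module_hom.add[OF assms] module_hom.scale[OF assms] algebra_simps
      scale_mult_left scale_mult_right)+

lemma module_hom_antipode: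
  "module_hom s' scale g \<Longrightarrow> module_hom s' scale (\<lambda>x. \<gamma> (g x))"
  using module_hom_compose[OF _ antipode_linear] by (simp add: comp_def)

lemma module_hom_id: "module_hom scale scale (\<lambda>x. x)"
  by (rule module_homI[OF module_axioms module_axioms]) auto

lemma module_hom_comp:
  "module_hom scale (*) \<phi> \<Longrightarrow> module_hom scale scale g \<Longrightarrow> module_hom scale (*) (\<lambda>x. \<phi> (g x))"
  using module_hom_compose[of scale scale g "(*)" \<phi>] by (simp add: comp_def)

lemmas hom_intros = module_hom_mult_rule module_hom_antipode module_hom_id
  module_hom_mult_const module_hom_contract_param bilinear_formI

lemma contract_counit_left:
  assumes "module_hom scale (*) \<phi>"
  shows "contract (\<Delta> x) (\<lambda>p. \<epsilon> (fst p) * \<phi> (snd p)) = \<phi> x"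
  using hom_lin_ext[OF assms, of "\<lambda>(x1, x2). scale (\<epsilon> x1) x2" "\<Delta> x"]
  by (simp add: case_prod_unfold counit_left[unfolded case_prod_unfold] module_hom.scale[OF assms])

lemma contract_counit_right:
  assumes "module_hom scale (*) \<phi>"
  shows "contract (\<Delta> x) (\<lambda>p. \<phi> (fst p) * \<epsilon> (snd p)) = \<phi> x"
  using hom_lin_ext[OF assms, of "\<lambda>(x1, x2). scale (\<epsilon> x2) x1" "\<Delta> x"]
  by (simp add: case_prod_unfold counit_right[unfolded case_prod_unfold] module_hom.scale[OF assms] mult.commute)

text \<open>The counit axiom inserts a factor \<epsilon>(x_2), multiplicativity merges it into
  \<epsilon>(\<gamma>(x_1) x_2), and the antipode axiom finishes.\<close>

lemma counit_antipode: "\<epsilon> (\<gamma> x) = \<epsilon> x"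
proof -
  have "\<epsilon> (\<gamma> x) = contract (\<Delta> x) (\<lambda>p. \<epsilon> (\<gamma> (fst p)) * \<epsilon> (snd p))"
    by (rule contract_counit_right[symmetric]) (intro module_hom_comp[OF counit_linear] hom_intros)
  also have "\<dots> = \<epsilon> (lin_ext scale (\<lambda>(x1, x2). \<gamma> x1 * x2) (\<Delta> x))"
    by (simp add: hom_lin_ext[OF counit_linear] case_prod_unfold counit_mult)
  also have "\<dots> = \<epsilon> x"
    by (simp add: antipode_left module_hom.scale[OF counit_linear] counit_one)
  finally show ?thesis .
qed

lemma contract_antipode_right:
  assumes "module_hom scale (*) \<phi>"
  shows "contract (\<Delta> x) (\<lambda>p. \<phi> (fst p * \<gamma> (snd p))) = \<epsilon> x * \<phi> 1"
  using hom_lin_ext[OF assms, of "\<lambda>(x1, x2). x1 * \<gamma> x2" "\<Delta> x"]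
  by (simp add: case_prod_unfold antipode_right[unfolded case_prod_unfold] module_hom.scale[OF assms])

end

locale quasitriangular_hopf_algebra_with_base =
  quasitriangular_hopf_algebra scale \<Delta> \<epsilon> \<gamma> R Rinv + module_with_base scale e
  for scale :: "'k::comm_ring_1 \<Rightarrow> 'h::ring_1 \<Rightarrow> 'h"
    and \<Delta> :: "'h \<Rightarrow> ('h \<times> 'h \<Rightarrow>\<^sub>0 'k)"
    and \<epsilon> :: "'h \<Rightarrow> 'k"
    and \<gamma> :: "'h \<Rightarrow> 'h"
    and R Rinv :: "'h \<times> 'h \<Rightarrow>\<^sub>0 'k"
    and e :: "'i \<Rightarrow> 'h"

section \<open>Identities of the R-matrix, tested on functionals\<close>

context quasitriangular_hopf_algebra
begin

lemma contract_R_Rinv: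
  "bilinear_form scale B \<Longrightarrow>
     contract R (\<lambda>a. contract Rinv (\<lambda>b. B (fst a * fst b, snd a * snd b))) = B (1, 1)"
  using tensor_eq2_contract[OF R_Rinv] by (simp add: contract_simps)

lemma contract_Rinv_R:
  "bilinear_form scale B \<Longrightarrow>
     contract Rinv (\<lambda>a. contract R (\<lambda>b. B (fst a * fst b, snd a * snd b))) = B (1, 1)"
  using tensor_eq2_contract[OF Rinv_R] by (simp add: contract_simps)

lemma counit_R_left:
  assumes \<phi>: "module_hom scale (*) \<phi>"
  shows "contract R (\<lambda>r. \<epsilon> (fst r) * \<phi> (snd r)) = \<phi> 1"
proof -
  note hom = hom_intros module_hom_comp[OF \<phi>] module_hom_comp[OF counit_linear]
  \<comment> \<open>\<open>(\<epsilon> \<otimes> id \<otimes> id)\<close> turns \<open>(\<Delta> \<otimes> id)(R) = R\<^sub>1\<^sub>3 R\<^sub>2\<^sub>3\<close> into \<open>R = (1 \<otimes> \<rho>) R\<close> with \<open>\<rho> = (\<epsilon> \<otimes> id)(R)\<close>;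
    the form \<open>B\<close> cancels \<open>R\<close> on the right.\<close>
  define B where "B = (\<lambda>(y, z). contract Rinv (\<lambda>c. \<epsilon> (y * fst c) * \<phi> (z * snd c)))"
  have B: "bilinear_form scale B"
    unfolding B_def by (intro bilinear_formI; simp only: prod.case; intro hom)
  have "contract R B = contract R (\<lambda>a. contract (\<Delta> (fst a)) (\<lambda>x. \<epsilon> (fst x) * B (snd x, snd a)))"
    by (subst contract_counit_left) (use B in \<open>auto simp: bilinear_form_def\<close>)
  also have "\<dots> = contract (comult_id \<Delta> R) (\<lambda>(x, y, z). \<epsilon> x * B (y, z))"
    by (simp add: contract_simps)
  also have "\<dots> = contract (tmult3 (leg13 R) (leg23 R)) (\<lambda>(x, y, z). \<epsilon> x * B (y, z))"
    by (intro tensor_eq3_contract[OF comult_id_R] trilinear_formI; simp only: prod.case;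
        intro hom bilinear_form_hom1[OF B] bilinear_form_hom2[OF B])
  also have "\<dots> = contract R (\<lambda>a. \<epsilon> (fst a) * contract R (\<lambda>b. B (fst b, snd a * snd b)))"
    by (simp add: contract_simps contract_mult_left)
  also have "\<dots> = contract R (\<lambda>a. \<epsilon> (fst a) * \<phi> (snd a))"
  proof -
    have "contract R (\<lambda>b. B (fst b, z * snd b)) = \<phi> z" for z
    proof -
      have "contract R (\<lambda>b. B (fst b, z * snd b)) = (\<lambda>(p, q). \<epsilon> p * \<phi> (z * q)) (1, 1)"
        by (subst contract_R_Rinv[symmetric]; (intro bilinear_formI; simp only: prod.case; intro hom)?)
          (simp add: B_def mult.assoc)
      then show ?thesis by (simp add: counit_one)
    qed
    then show ?thesis by simp
  qed
  finally have "contract R B = contract R (\<lambda>a. \<epsilon> (fst a) * \<phi> (snd a))" .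
  moreover have "contract R B = (\<lambda>(p, q). \<epsilon> p * \<phi> q) (1, 1)"
    by (subst contract_R_Rinv[of "\<lambda>(p, q). \<epsilon> p * \<phi> q", symmetric];
        (intro bilinear_formI; simp only: prod.case; intro hom)?)
      (simp add: B_def case_prod_unfold)
  ultimately show ?thesis by (simp add: counit_one)
qed

text \<open>Mirror image of \<open>counit_R_left\<close>: applying \<epsilon> to the middle leg of
  (id \<otimes> \<Delta>)(R) = R_13 R_12 gives R = R (\<rho> \<otimes> 1) with \<rho> = (id
  \<otimes> \<epsilon>)(R). The form \<open>B\<close> multiplies by \<open>Rinv\<close> on the left
  and so cancels R.\<close>

lemma counit_R_right:
  assumes \<phi>: "module_hom scale (*) \<phi>"
  shows "contract R (\<lambda>r. \<phi> (fst r) * \<epsilon> (snd r)) = \<phi> 1"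
proof -
  note hom = hom_intros module_hom_comp[OF \<phi>] module_hom_comp[OF counit_linear]
  define B where "B = (\<lambda>(y, z). contract Rinv (\<lambda>c. \<phi> (fst c * y) * \<epsilon> (snd c * z)))"
  have B: "bilinear_form scale B"
    unfolding B_def by (intro bilinear_formI; simp only: prod.case; intro hom)
  have B_R: "contract R (\<lambda>r. B (fst r * z, snd r)) = \<phi> z" for z
  proof -
    \<comment> \<open>The value is written as a bilinear form at (1, 1) so that the product of
      \<open>Rinv\<close> and \<open>R\<close> can be inserted there.\<close>
    have "contract R (\<lambda>r. B (fst r * z, snd r)) = (\<lambda>(p, q). \<phi> (p * z) * \<epsilon> q) (1, 1)"
      by (subst contract_Rinv_R[symmetric]; (intro bilinear_formI; simp only: prod.case; intro hom)?)
        (subst contract_swap, simp add: B_def mult.assoc)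
    then show ?thesis by (simp add: counit_one)
  qed
  have "\<phi> 1 = contract R (\<lambda>a. B (fst a, snd a))"
    using B_R[of 1] by simp
  also have "\<dots> = contract R (\<lambda>a. contract (\<Delta> (snd a)) (\<lambda>x. \<epsilon> (fst x) * B (fst a, snd x)))"
    by (subst contract_counit_left) (use B in \<open>auto simp: bilinear_form_def\<close>)
  also have "\<dots> = contract (id_comult \<Delta> R) (\<lambda>(x, y, z). \<epsilon> y * B (x, z))"
    by (simp add: contract_simps case_prod_unfold)
  also have "\<dots> = contract (tmult3 (leg13 R) (leg12 R)) (\<lambda>(x, y, z). \<epsilon> y * B (x, z))"
    by (intro tensor_eq3_contract[OF id_comult_R] trilinear_formI; simp only: prod.case;
        intro hom bilinear_form_hom1[OF B] bilinear_form_hom2[OF B])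
  also have "\<dots> = contract R (\<lambda>b. \<epsilon> (snd b) * contract R (\<lambda>a. B (fst a * fst b, snd a)))"
    by (subst contract_mult_left[symmetric], subst contract_swap) (simp add: contract_simps)
  also have "\<dots> = contract R (\<lambda>r. \<phi> (fst r) * \<epsilon> (snd r))"
    by (simp add: B_R mult.commute)
  finally show ?thesis by simp
qed

text \<open>Here \<open>r\<close> is the copy R_13 and \<open>s\<close> the copy R_12. On (id
  \<otimes> \<Delta>)(R) the form (x, y, z) to B(x, y \<gamma>(z)) collapses by the antipode axiom,
  and the remaining \<epsilon>(R_2) is removed by \<open>counit_R_right\<close>.\<close>

lemma R_antipode_cancel:
  assumes B: "bilinear_form scale B"
  shows "contract R (\<lambda>r. contract R (\<lambda>s. B (fst r * fst s, snd s * \<gamma> (snd r)))) = B (1, 1)"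
proof -
  note hom = hom_intros bilinear_form_hom1[OF B] bilinear_form_hom2[OF B]
  have "contract R (\<lambda>r. contract R (\<lambda>s. B (fst r * fst s, snd s * \<gamma> (snd r))))
      = contract (tmult3 (leg13 R) (leg12 R)) (\<lambda>(x, y, z). B (x, y * \<gamma> z))"
    by (simp add: contract_simps)
  also have "\<dots> = contract (id_comult \<Delta> R) (\<lambda>(x, y, z). B (x, y * \<gamma> z))"
    by (intro tensor_eq3_contract[OF id_comult_R, symmetric] trilinear_formI; simp only: prod.case; intro hom)
  also have "\<dots> = contract R (\<lambda>a. \<epsilon> (snd a) * B (fst a, 1))"
    by (simp add: contract_simps case_prod_unfold) (subst contract_antipode_right; (intro hom)?; simp)
  also have "\<dots> = B (1, 1)"
    using counit_R_right[of "\<lambda>x. B (x, 1)"] by (simp add: mult.commute hom)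
  finally show ?thesis .
qed

text \<open>The equation \<gamma>(1) = 1 in weak form: \<open>\<Delta> 1\<close> is given only up to
  \<open>tensor_eq2\<close>, which is exploited through scalar valued forms.\<close>

lemma hom_antipode_one:
  assumes \<phi>: "module_hom scale (*) \<phi>"
  shows "\<phi> (\<gamma> 1) = \<phi> 1"
proof -
  note hom = hom_intros module_hom_comp[OF \<phi>]
  have "\<phi> (\<gamma> 1) = contract (gen (1, 1)) (\<lambda>(x, y). \<phi> (\<gamma> x * y))"
    by (simp add: contract_gen)
  also have "\<dots> = contract (\<Delta> 1) (\<lambda>(x, y). \<phi> (\<gamma> x * y))"
    by (intro tensor_eq2_contract[OF comult_one, symmetric] bilinear_formI; simp only: prod.case; intro hom)
  also have "\<dots> = \<epsilon> 1 * \<phi> 1"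
    using hom_lin_ext[OF \<phi>, of "\<lambda>(x1, x2). \<gamma> x1 * x2" "\<Delta> 1"]
    by (simp add: case_prod_unfold antipode_left[unfolded case_prod_unfold] module_hom.scale[OF \<phi>])
  finally show ?thesis by (simp add: counit_one)
qed

text \<open>This makes \<epsilon> a left unit of the twisted product. Multiplicativity splits the
  counit into three factors, which collapse \<Delta>(h) and both copies of R separately.\<close>

lemma counit_R_twist_left:
  assumes \<phi>: "module_hom scale (*) \<phi>"
  shows "contract R (\<lambda>r. contract R (\<lambda>r'. contract (\<Delta> h) (\<lambda>x.
      \<epsilon> (fst r' * (fst x * fst r)) * \<phi> (\<gamma> (snd r) * (snd r' * snd x))))) = \<phi> h"
proof -
  note hom = hom_intros module_hom_comp[OF \<phi>]
  have "contract (\<Delta> h) (\<lambda>x. \<epsilon> (fst r' * (fst x * fst r)) * \<phi> (\<gamma> (snd r) * (snd r' * snd x)))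
      = \<epsilon> (fst r) * (\<epsilon> (fst r') * \<phi> (\<gamma> (snd r) * (snd r' * h)))" for r r'
    by (subst contract_counit_left[symmetric, where x = h]; (intro hom)?)
      (simp add: counit_mult contract_mult_left[symmetric] ac_simps)
  moreover have "contract R (\<lambda>r'. \<epsilon> (fst r') * \<phi> (z * (snd r' * h))) = \<phi> (z * h)" for z
    by (subst counit_R_left; (intro hom)?; simp)
  \<comment> \<open>Removing this copy of R leaves \<gamma>(1) in front of \<open>h\<close>, hence
    the use of \<open>hom_antipode_one\<close>.\<close>
  moreover have "contract R (\<lambda>r. \<epsilon> (fst r) * \<phi> (\<gamma> (snd r) * h)) = \<phi> h"
    using hom_antipode_one[of "\<lambda>x. \<phi> (x * h)"] by (subst counit_R_left; (intro hom)?; simp add: hom)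
  ultimately show ?thesis by (simp add: contract_mult_left)
qed

text \<open>The right unit law. Now the counit meets \<gamma>(R_2), which
  \<open>counit_antipode\<close> turns into \<epsilon>(R_2).\<close>

lemma counit_R_twist_right:
  assumes \<phi>: "module_hom scale (*) \<phi>"
  shows "contract R (\<lambda>r. contract R (\<lambda>r'. contract (\<Delta> h) (\<lambda>x.
      \<phi> (fst r' * (fst x * fst r)) * \<epsilon> (\<gamma> (snd r) * (snd r' * snd x))))) = \<phi> h"
proof -
  note hom = hom_intros module_hom_comp[OF \<phi>]
  have "contract (\<Delta> h) (\<lambda>x. \<phi> (fst r' * (fst x * fst r)) * \<epsilon> (\<gamma> (snd r) * (snd r' * snd x)))
      = (\<phi> (fst r' * (h * fst r)) * \<epsilon> (snd r')) * \<epsilon> (snd r)" for r r'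
    by (subst contract_counit_right[symmetric, where x = h]; (intro hom)?)
      (simp add: counit_mult counit_antipode contract_mult_right[symmetric] ac_simps)
  moreover have "contract R (\<lambda>r'. \<phi> (fst r' * z) * \<epsilon> (snd r')) = \<phi> z" for z
    by (subst counit_R_right; (intro hom)?; simp)
  moreover have "contract R (\<lambda>r. \<phi> (h * fst r) * \<epsilon> (snd r)) = \<phi> h"
    by (subst counit_R_right; (intro hom)?; simp)
  ultimately show ?thesis by (simp add: contract_mult_right)
qed

end

section \<open>Products in the completed tensor product\<close>

text \<open>Exchanging sums is not an oriented rewrite rule, so the needed permutation is fixed
  once. It moves the outer copy \<open>A\<close> of R, the one carrying the antipode, next to the
  copy \<open>S\<close> that stands between the canonical elements.\<close>

lemma contract_rotate3:
  "contract A (\<lambda>a. contract B (\<lambda>b. contract C (\<lambda>c. contract S (\<lambda>s. f a b c s))))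
   = contract B (\<lambda>b. contract C (\<lambda>c. contract A (\<lambda>a. contract S (\<lambda>s. f a b c s))))"
  by (simp only: contract_swap[where t = A and u = B] contract_swap[where t = A and u = C])

lemma contract_rotate4:
  "contract A (\<lambda>a. contract B (\<lambda>b. contract C (\<lambda>c. contract T (\<lambda>t. contract S (\<lambda>s. f a b c t s)))))
   = contract T (\<lambda>t. contract B (\<lambda>b. contract C (\<lambda>c. contract A (\<lambda>a. contract S (\<lambda>s. f a b c t s)))))"
  by (simp only: contract_swap[where t = C and u = T] contract_swap[where t = B and u = T]
      contract_swap[where t = A and u = T])
    (simp only: contract_swap[where t = A and u = B] contract_swap[where t = A and u = C])

context quasitriangular_hopf_algebra_with_base
begin

text \<open>Linearity into the tensor product rather than into formal combinations:
  \<open>\<Delta>\<close>, for instance, is additive only up to \<open>tensor_eq2\<close>.\<close>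

definition tensor_linear :: "('h \<Rightarrow> 'h \<times> 'h \<Rightarrow>\<^sub>0 'k) \<Rightarrow> bool" where
  "tensor_linear F \<longleftrightarrow> (\<forall>B. bilinear_form scale B \<longrightarrow> module_hom scale (*) (\<lambda>x. contract (F x) B))"

abbreviation compl_mult_syntax (infixl \<open>\<odot>\<close> 70) where
  "X \<odot> Y \<equiv> compl_mult scale e \<Delta> \<gamma> R X Y"

lemma contract_compl_mult:
  "contract ((X \<odot> Y) k) f =
     contract R (\<lambda>r. contract R (\<lambda>r'. contract (\<Delta> (e k)) (\<lambda>x.
       contract (coords scale e (fst r' * (fst x * fst r))) (\<lambda>i.
         contract (coords scale e (\<gamma> (snd r) * (snd r' * snd x))) (\<lambda>j.
           contract (tmult2 (X i) (Y j)) f)))))"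
proof -
  \<comment> \<open>The coefficient of \<open>M\<close> at (i, j) is the structure constant of the
    RE product of the i-th and j-th dual base functionals at \<open>e k\<close>. As \<open>M\<close>
    has finite support, \<open>Sum_any\<close> becomes a linear extension over it.\<close>
  define M where "M = lin_ext fscale (\<lambda>r. lin_ext fscale (\<lambda>r'. lin_ext fscale (\<lambda>x.
    formal_tensor (coords scale e (fst r' * (fst x * fst r)))
      (coords scale e (\<gamma> (snd r) * (snd r' * snd x)))) (\<Delta> (e k))) R) R"
  have M: "Poly_Mapping.lookup M (i, j) = re_mult \<Delta> \<gamma> R (dual_base scale e i) (dual_base scale e j) (e k)" for i j
    by (simp add: M_def lookup_lin_ext lookup_formal_tensor lookup_coords re_mult_def dual_mult_def
        lcoreg_def rcoreg_def case_prod_unfold mult.assoc)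
  have "(X \<odot> Y) k = Sum_any (\<lambda>p. fscale (Poly_Mapping.lookup M p) (tmult2 (X (fst p)) (Y (snd p))))"
    by (simp add: compl_mult_def M case_prod_unfold) (simp flip: M)
  also have "\<dots> = lin_ext fscale (\<lambda>(i, j). tmult2 (X i) (Y j)) M"
    unfolding lin_ext_def
    by (subst Sum_any.expand_superset[of "Poly_Mapping.keys M"]) (auto simp: in_keys_iff case_prod_unfold)
  finally show ?thesis
    by (simp add: contract_lin_ext M_def contract_formal_tensor)
qed

text \<open>The base disappears from the product: \<open>P\<close> is bilinear, so the double sum
  over coordinates reassembles to \<open>P\<close> at the twisted legs of \<Delta>(e_k).\<close>

lemma contract_compl_mult_family:
  assumes F: "tensor_linear F" "\<And>i. tensor_eq2 scale (X i) (F (e i))"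
    and G: "tensor_linear G" "\<And>i. tensor_eq2 scale (Y i) (G (e i))"
    and B: "bilinear_form scale B"
  shows "contract ((X \<odot> Y) k) B =
     contract R (\<lambda>r. contract R (\<lambda>r'. contract (\<Delta> (e k)) (\<lambda>x.
       contract (tmult2 (F (fst r' * (fst x * fst r))) (G (\<gamma> (snd r) * (snd r' * snd x)))) B)))"
proof -
  note hom = hom_intros bilinear_form_hom1[OF B] bilinear_form_hom2[OF B]
  define P where "P = (\<lambda>(x, y). contract (tmult2 (F x) (G y)) B)"
  have b1: "bilinear_form scale (\<lambda>a. contract t (\<lambda>b. B (fst a * fst b, snd a * snd b)))" for t
    by (intro bilinear_formI; simp only: fst_conv snd_conv; intro hom)
  have b2: "bilinear_form scale (\<lambda>b. contract t (\<lambda>a. B (fst a * fst b, snd a * snd b)))" for t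
    by (intro bilinear_formI; simp only: fst_conv snd_conv; intro hom)
  have P: "bilinear_form scale P"
    unfolding P_def
  proof (intro bilinear_formI; simp only: prod.case)
    show "module_hom scale (*) (\<lambda>x. contract (tmult2 (F x) (G y)) B)" for y
      using F(1) b1 unfolding contract_tmult2 tensor_linear_def by blast
    show "module_hom scale (*) (\<lambda>y. contract (tmult2 (F x) (G y)) B)" for x
      using G(1) b2 unfolding contract_tmult2 tensor_linear_def by (subst contract_swap) blast
  qed
  have XY: "contract (tmult2 (X i) (Y j)) B = P (e i, e j)" for i j
  proof -
    have "contract (tmult2 (X i) (Y j)) B = contract (tmult2 (F (e i)) (Y j)) B"
      unfolding contract_tmult2 by (rule tensor_eq2_contract[OF F(2) b1])
    also have "\<dots> = contract (tmult2 (F (e i)) (G (e j))) B"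
      \<comment> \<open>The swap puts the sum over the second factor outermost, where it can be
        replaced by an equal tensor.\<close>
      unfolding contract_tmult2 by (subst (1 2) contract_swap) (rule tensor_eq2_contract[OF G(2) b2])
    finally show ?thesis by (simp add: P_def)
  qed
  show ?thesis
    unfolding contract_compl_mult XY bilinear_form_eq_contract_coords[OF P, symmetric] by (simp add: P_def)
qed

text \<open>The result is again a family of values \<open>Z (e k)\<close>, so products of several
  factors can be computed one multiplication at a time.\<close>

lemma compl_mult_familyI:
  assumes F: "tensor_linear F" "\<And>i. tensor_eq2 scale (X i) (F (e i))"
    and G: "tensor_linear G" "\<And>i. tensor_eq2 scale (Y i) (G (e i))"
    and Z: "\<And>B h. bilinear_form scale B \<Longrightarrow>
      contract R (\<lambda>r. contract R (\<lambda>r'. contract (\<Delta> h) (\<lambda>x.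
       contract (tmult2 (F (fst r' * (fst x * fst r))) (G (\<gamma> (snd r) * (snd r' * snd x)))) B)))
      = contract (Z h) B"
  shows "tensor_eq2 scale ((X \<odot> Y) k) (Z (e k))"
  by (rule tensor_eq2I) (simp add: contract_compl_mult_family[OF F G] Z)

section \<open>Constructions of tensor-linear families\<close>

lemma tensor_linear_tmult2_left:
  assumes "tensor_linear F"
  shows "tensor_linear (\<lambda>h. tmult2 T (F h))"
  unfolding tensor_linear_def
proof (intro allI impI)
  fix B :: "'h \<times> 'h \<Rightarrow> 'k" assume B: "bilinear_form scale B"
  have "bilinear_form scale (\<lambda>b. contract T (\<lambda>a. B (fst a * fst b, snd a * snd b)))"
    by (intro bilinear_formI; simp only: fst_conv snd_conv;
        intro hom_intros bilinear_form_hom1[OF B] bilinear_form_hom2[OF B])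
  with assms show "module_hom scale (*) (\<lambda>h. contract (tmult2 T (F h)) B)"
    unfolding contract_tmult2 tensor_linear_def by (subst contract_swap) blast
qed

lemma tensor_linear_tmult2_right:
  assumes "tensor_linear F"
  shows "tensor_linear (\<lambda>h. tmult2 (F h) T)"
  unfolding tensor_linear_def
proof (intro allI impI)
  fix B :: "'h \<times> 'h \<Rightarrow> 'k" assume B: "bilinear_form scale B"
  have "bilinear_form scale (\<lambda>a. contract T (\<lambda>b. B (fst a * fst b, snd a * snd b)))"
    by (intro bilinear_formI; simp only: fst_conv snd_conv;
        intro hom_intros bilinear_form_hom1[OF B] bilinear_form_hom2[OF B])
  with assms show "module_hom scale (*) (\<lambda>h. contract (tmult2 (F h) T) B)"
    unfolding contract_tmult2 tensor_linear_def by blast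
qed

lemma tensor_linear_flip:
  assumes "tensor_linear F"
  shows "tensor_linear (\<lambda>h. flip (F h))"
  unfolding tensor_linear_def
proof (intro allI impI)
  fix B :: "'h \<times> 'h \<Rightarrow> 'k" assume "bilinear_form scale B"
  then have "bilinear_form scale (\<lambda>a. B (snd a, fst a))"
    by (simp add: bilinear_form_def)
  with assms show "module_hom scale (*) (\<lambda>h. contract (flip (F h)) B)"
    unfolding contract_legs tensor_linear_def by blast
qed

lemma tensor_linear_comult: "tensor_linear \<Delta>"
  unfolding tensor_linear_def
proof (intro allI impI)
  fix B :: "'h \<times> 'h \<Rightarrow> 'k" assume B: "bilinear_form scale B"
  show "module_hom scale (*) (\<lambda>h. contract (\<Delta> h) B)"
    by (rule module_homI[OF module_axioms module_mult])
      (simp_all add: tensor_eq2_contract[OF comult_add B] tensor_eq2_contract[OF comult_scale B] contract_simps)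
qed

lemma tensor_linear_legs:
  "tensor_linear (\<lambda>h. gen (h, 1))" "tensor_linear (\<lambda>h. gen (1, h))"
  by (simp_all add: tensor_linear_def contract_gen bilinear_form_def)

lemma tensor_linear_counit: "tensor_linear (\<lambda>h. fscale (\<epsilon> h) T)"
  unfolding tensor_linear_def contract_fscale using counit_linear by (intro allI impI module_hom_mult_const)

lemma tensor_eq2_refl: "tensor_eq2 scale t t"
  by (simp add: tensor_eq2_def formal.span_zero)

lemma dual_tensor_one_mult:
  assumes F: "tensor_linear F" "\<And>i. tensor_eq2 scale (X i) (F (e i))"
  shows "tensor_eq2 scale ((dual_tensor_one e \<epsilon> T \<odot> X) k) (tmult2 T (F (e k)))"
proof (rule compl_mult_familyI[OF tensor_linear_counit _ F])
  show "tensor_eq2 scale (dual_tensor_one e \<epsilon> T i) (fscale (\<epsilon> (e i)) T)" for i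
    by (simp add: dual_tensor_one_def tensor_eq2_refl)
  fix B :: "'h \<times> 'h \<Rightarrow> 'k" and h assume B: "bilinear_form scale B"
  have "contract (tmult2 (fscale c T) t) B = c * contract (tmult2 T t) B" for c t
    by (simp add: contract_simps)
  then show "contract R (\<lambda>r. contract R (\<lambda>r'. contract (\<Delta> h) (\<lambda>x.
      contract (tmult2 (fscale (\<epsilon> (fst r' * (fst x * fst r))) T)
        (F (\<gamma> (snd r) * (snd r' * snd x)))) B))) = contract (tmult2 T (F h)) B"
    using counit_R_twist_left[of "\<lambda>y. contract (tmult2 T (F y)) B"] B
      tensor_linear_tmult2_left[OF F(1), of T]
    by (simp add: tensor_linear_def)
qed

lemma mult_dual_tensor_one:
  assumes F: "tensor_linear F" "\<And>i. tensor_eq2 scale (X i) (F (e i))"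
  shows "tensor_eq2 scale ((X \<odot> dual_tensor_one e \<epsilon> T) k) (tmult2 (F (e k)) T)"
proof (rule compl_mult_familyI[OF F tensor_linear_counit])
  show "tensor_eq2 scale (dual_tensor_one e \<epsilon> T i) (fscale (\<epsilon> (e i)) T)" for i
    by (simp add: dual_tensor_one_def tensor_eq2_refl)
  fix B :: "'h \<times> 'h \<Rightarrow> 'k" and h assume B: "bilinear_form scale B"
  have "contract (tmult2 t (fscale c T)) B = contract (tmult2 t T) B * c" for c t
    by (simp add: contract_simps contract_mult_left)
  then show "contract R (\<lambda>r. contract R (\<lambda>r'. contract (\<Delta> h) (\<lambda>x.
      contract (tmult2 (F (fst r' * (fst x * fst r)))
        (fscale (\<epsilon> (\<gamma> (snd r) * (snd r' * snd x))) T)) B))) = contract (tmult2 (F h) T) B"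
    using counit_R_twist_right[of "\<lambda>y. contract (tmult2 (F y) T) B"] B
      tensor_linear_tmult2_right[OF F(1), of T]
    by (simp add: tensor_linear_def)
qed

section \<open>The canonical element and its two equations\<close>

abbreviation "K1 \<equiv> compl_leg1 (canonical_element e)"
abbreviation "K2 \<equiv> compl_leg2 (canonical_element e)"
abbreviation "one_tensor \<equiv> dual_tensor_one e \<epsilon>"

lemma K1_eq: "tensor_eq2 scale (K1 i) (gen (e i, 1))"
  and K2_eq: "tensor_eq2 scale (K2 i) (gen (1, e i))"
  by (simp_all add: compl_leg1_def compl_leg2_def canonical_element_def tensor_eq2_refl)

text \<open>\<open>R_antipode_cancel\<close> inside a longer product, bracketed to the right as
  \<open>mult.assoc\<close> leaves it.\<close>

lemma R_antipode_cancel_within: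
  assumes B: "bilinear_form scale B"
  shows "contract R (\<lambda>r. contract R (\<lambda>s.
      B (a * (b * (c * (fst r * fst s))), a' * (snd s * (\<gamma> (snd r) * b'))))) = B (a * (b * c), a' * b')"
proof -
  have "contract R (\<lambda>r. contract R (\<lambda>s.
      (\<lambda>(p, q). B (a * (b * (c * p)), a' * (q * b'))) (fst r * fst s, snd s * \<gamma> (snd r))))
    = B (a * (b * c), a' * b')"
    by (subst R_antipode_cancel; (intro bilinear_formI; simp only: prod.case;
      intro hom_intros bilinear_form_hom1[OF B] bilinear_form_hom2[OF B])?) simp
  then show ?thesis by (simp add: mult.assoc)
qed

text \<open>The prefix \<open>T\<close> is kept general to serve both equations, with
  \<open>Rinv\<close> in the first and \<open>flip R\<close> in the second.\<close>

lemma tensor_K1_R_K2: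
  "tensor_eq2 scale ((one_tensor T \<odot> K1 \<odot> one_tensor R \<odot> K2) k) (tmult2 T (tmult2 R (\<Delta> (e k))))"
proof (rule compl_mult_familyI[OF _ _ tensor_linear_legs(2) K2_eq])
  note lin = tensor_linear_tmult2_left[OF tensor_linear_legs(1), of T]
  show "tensor_linear (\<lambda>h. tmult2 (tmult2 T (gen (h, 1))) R)"
    by (rule tensor_linear_tmult2_right[OF lin])
  show "tensor_eq2 scale ((one_tensor T \<odot> K1 \<odot> one_tensor R) i) (tmult2 (tmult2 T (gen (e i, 1))) R)" for i
    by (rule mult_dual_tensor_one[OF lin dual_tensor_one_mult[OF tensor_linear_legs(1) K1_eq]])
  fix B :: "'h \<times> 'h \<Rightarrow> 'k" and h assume B: "bilinear_form scale B"
  show "contract R (\<lambda>r. contract R (\<lambda>r'. contract (\<Delta> h) (\<lambda>x.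
      contract (tmult2 (tmult2 (tmult2 T (gen (fst r' * (fst x * fst r), 1))) R)
        (gen (1, \<gamma> (snd r) * (snd r' * snd x)))) B))) = contract (tmult2 T (tmult2 R (\<Delta> h))) B"
    by (simp add: contract_simps mult.assoc)
      \<comment> \<open>Once \<open>r\<close> stands next to the inserted copy of R, the two cancel;
        the copy \<open>r'\<close> and \<Delta>(h) remain and form R \<Delta>(h).\<close>
      (subst contract_rotate4, simp add: R_antipode_cancel_within[OF B])
qed

text \<open>The same cancellation with the two legs exchanged, hence the transposed form
  \<open>B'\<close>; there is no prefix, so its slots are filled with 1.\<close>

lemma K2_R21_K1:
  "tensor_eq2 scale ((K2 \<odot> one_tensor (flip R) \<odot> K1) k) (flip (tmult2 R (\<Delta> (e k))))"
proof (rule compl_mult_familyI[OF _ _ tensor_linear_legs(1) K1_eq])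
  show "tensor_linear (\<lambda>h. tmult2 (gen (1, h)) (flip R))"
    by (rule tensor_linear_tmult2_right[OF tensor_linear_legs(2)])
  show "tensor_eq2 scale ((K2 \<odot> one_tensor (flip R)) i) (tmult2 (gen (1, e i)) (flip R))" for i
    by (rule mult_dual_tensor_one[OF tensor_linear_legs(2) K2_eq])
  fix B :: "'h \<times> 'h \<Rightarrow> 'k" and h assume B: "bilinear_form scale B"
  have B': "bilinear_form scale (\<lambda>(p, q). B (q, p))"
    using B by (simp add: bilinear_form_def)
  show "contract R (\<lambda>r. contract R (\<lambda>r'. contract (\<Delta> h) (\<lambda>x.
      contract (tmult2 (tmult2 (gen (1, fst r' * (fst x * fst r))) (flip R))
        (gen (\<gamma> (snd r) * (snd r' * snd x), 1))) B))) = contract (flip (tmult2 R (\<Delta> h))) B"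
    using R_antipode_cancel_within[OF B', of 1 _ _ 1]
    by (simp add: contract_simps mult.assoc) (subst contract_rotate3, simp)
qed

lemma K2_R21_K1_R:
  "tensor_eq2 scale ((K2 \<odot> one_tensor (flip R) \<odot> K1 \<odot> one_tensor R) k)
     (tmult2 (flip (tmult2 R (\<Delta> (e k)))) R)"
  by (intro mult_dual_tensor_one tensor_linear_flip tensor_linear_tmult2_left tensor_linear_comult K2_R21_K1)

lemma characteristic_equation:
  "tensor_eq2 scale (\<Delta> (e k)) ((one_tensor Rinv \<odot> K1 \<odot> one_tensor R \<odot> K2) k)"
proof (rule tensor_eq2I)
  fix B :: "'h \<times> 'h \<Rightarrow> 'k" assume B: "bilinear_form scale B"
  \<comment> \<open>The factors 1 mark the place where 1 \<otimes> 1 is replaced by the product of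
    \<open>Rinv\<close> and \<open>R\<close>.\<close>
  have "contract (\<Delta> (e k)) (\<lambda>x. B (1 * fst x, 1 * snd x)) =
      contract (tmult2 (tmult2 Rinv R) (\<Delta> (e k))) B"
    unfolding contract_tmult2[where t = "tmult2 Rinv R"]
    by (subst tensor_eq2_contract[OF Rinv_R]; (intro bilinear_formI; simp only: fst_conv snd_conv;
      intro hom_intros bilinear_form_hom1[OF B] bilinear_form_hom2[OF B])?) (simp add: contract_gen)
  also have "\<dots> = contract (tmult2 Rinv (tmult2 R (\<Delta> (e k)))) B"
    by (simp add: contract_simps mult.assoc)
  also have "\<dots> = contract ((one_tensor Rinv \<odot> K1 \<odot> one_tensor R \<odot> K2) k) B"
    using tensor_eq2_contract[OF tensor_K1_R_K2 B] by simp
  finally show "contract (\<Delta> (e k)) B = contract ((one_tensor Rinv \<odot> K1 \<odot> one_tensor R \<odot> K2) k) B"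
    by simp
qed

text \<open>The left side is R_21 R \<Delta>(e_k) = R_21 \<Delta>^op(e_k) R by the intertwining
  property. Since the flip is multiplicative, R_21 \<Delta>^op(e_k) is the flip of R \<Delta>(e_k),
  which gives the right side.\<close>

lemma reflection_equation:
  "tensor_eq2 scale ((one_tensor (flip R) \<odot> K1 \<odot> one_tensor R \<odot> K2) k)
     ((K2 \<odot> one_tensor (flip R) \<odot> K1 \<odot> one_tensor R) k)"
proof (rule tensor_eq2I)
  fix B :: "'h \<times> 'h \<Rightarrow> 'k" assume B: "bilinear_form scale B"
  have "bilinear_form scale (\<lambda>b. contract (flip R) (\<lambda>a. B (fst a * fst b, snd a * snd b)))"
    by (intro bilinear_formI; simp only: fst_conv snd_conv;
      intro hom_intros bilinear_form_hom1[OF B] bilinear_form_hom2[OF B])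
  from tensor_eq2_contract[OF R_intertwines this]
  have "contract (tmult2 (flip R) (tmult2 R (\<Delta> (e k)))) B
      = contract (tmult2 (flip R) (tmult2 (flip (\<Delta> (e k))) R)) B"
    unfolding contract_tmult2[where t = "flip R"] by (subst (1 2) contract_swap)
  also have "\<dots> = contract (tmult2 (flip (tmult2 R (\<Delta> (e k)))) R) B"
    by (simp add: contract_simps mult.assoc)
  finally show "contract ((one_tensor (flip R) \<odot> K1 \<odot> one_tensor R \<odot> K2) k) B
      = contract ((K2 \<odot> one_tensor (flip R) \<odot> K1 \<odot> one_tensor R) k) B"
    using tensor_eq2_contract[OF tensor_K1_R_K2 B] tensor_eq2_contract[OF K2_R21_K1_R B] by simp
qed

end

theorem mainTheorem2:
  fixes \<iota> :: "'f::field_char_0 \<Rightarrow> 'k::comm_ring_1"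
    and scale :: "'k \<Rightarrow> 'h::ring_1 \<Rightarrow> 'h"
    and \<Delta> :: "'h \<Rightarrow> ('h \<times> 'h \<Rightarrow>\<^sub>0 'k)"
    and \<epsilon> :: "'h \<Rightarrow> 'k"
    and \<gamma> :: "'h \<Rightarrow> 'h"
    and R Rinv :: "'h \<times> 'h \<Rightarrow>\<^sub>0 'k"
    and e :: "'i \<Rightarrow> 'h"
    and mul :: "('i \<Rightarrow> ('h \<times> 'h \<Rightarrow>\<^sub>0 'k)) \<Rightarrow> ('i \<Rightarrow> ('h \<times> 'h \<Rightarrow>\<^sub>0 'k)) \<Rightarrow> ('i \<Rightarrow> ('h \<times> 'h \<Rightarrow>\<^sub>0 'k))"
      (infixl \<open>\<odot>\<close> 70)
    and K1 K2 R12 R21 R12inv :: "'i \<Rightarrow> ('h \<times> 'h \<Rightarrow>\<^sub>0 'k)"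
  assumes ground_ring: "\<iota> 1 = 1" "\<And>a b. \<iota> (a + b) = \<iota> a + \<iota> b" "\<And>a b. \<iota> (a * b) = \<iota> a * \<iota> b"
    and H: "quasitriangular_hopf_algebra scale \<Delta> \<epsilon> \<gamma> R Rinv"
    and base: "is_base scale e"
  defines "mul \<equiv> compl_mult scale e \<Delta> \<gamma> R"
    and "K1 \<equiv> compl_leg1 (canonical_element e)"
    and "K2 \<equiv> compl_leg2 (canonical_element e)"
    and "R12 \<equiv> dual_tensor_one e \<epsilon> R"
    and "R21 \<equiv> dual_tensor_one e \<epsilon> (flip R)"
    and "R12inv \<equiv> dual_tensor_one e \<epsilon> Rinv"
  shows "compl_eq scale (compl_comult_id \<Delta> (canonical_element e)) (R12inv \<odot> K1 \<odot> R12 \<odot> K2)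
    \<and> compl_eq scale (R21 \<odot> K1 \<odot> R12 \<odot> K2) (K2 \<odot> R21 \<odot> K1 \<odot> R12)"
proof -
  interpret quasitriangular_hopf_algebra scale \<Delta> \<epsilon> \<gamma> R Rinv by (rule H)
  interpret quasitriangular_hopf_algebra_with_base scale \<Delta> \<epsilon> \<gamma> R Rinv e
    using base by unfold_locales
  show ?thesis
    using characteristic_equation reflection_equation
    \<comment> \<open>The facts \<open>assms(6-)\<close> are the equations introduced by
      \<open>defines\<close>.\<close>
    by (simp add: assms(6-) compl_eq_def compl_comult_id_def canonical_element_def)
qed

end
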